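(* Let $(X,\alpha,G)$ be a partial dynamical system. The following conditions are equivalent: (i) $C(X)$ is $\alpha$-simple. (ii) $X$ does not have non-empty proper $\alpha$-invariant closed subsets. (iii) $(X,\alpha,G)$ is minimal.
   Context: A partial dynamical system $(X,\alpha,G)$ consists of a topological group $G$ (identity $e$), a topological space $X$, open subsets $\{X_t\}_{t\in G}$ of $X$ and homeomorphisms $\alpha_t:X_{t^{-1}}\to X_t$ such that: $X_e=X$ and $\alpha_e=\mathrm{id}_X$; $\alpha_t(X_{t^{-1}}\cap X_s)=X_t\cap X_{ts}$; $\alpha_t(\alpha_s(x))=\alpha_{ts}(x)$ for all $x\in\alpha_{s^{-1}}(X_s\cap X_{t^{-1}})$; the set $\Gamma_\alpha=\{(t,x)\in G\times X: x\in X_{t^{-1}}\}$ is open in $G\times X$ and $\Gamma_\alpha\to X$, $(t,x)\mapsto\alpha_t(x)$, is continuous. A subset $Y\subseteq X$ is $\alpha$-invariant if $\alpha_g(Y\cap X_{g^{-1}})=Y\cap X_g$ for all $g\in G$. The partial orbit of $x$ is $O^{\alpha}(x)=\{\alpha_t(x): t\in G,\ x\in X_{t^{-1}}\}$; the system is minimal if $O^\alpha(x)$ is dense in $X$ for every $x\in X$. $C(X)$ is the algebra of all continuous functions $X\to\mathbb{C}$ with pointwise operations. For open $Y\subseteq X$, $C(Y)$ is regarded as an ideal of $C(X)$, namely the functions in $C(X)$ vanishing outside $Y$. The partial action extends to $C(X)$ with ideals $C(X_t)$ and ring isomorphisms $\alpha_t:C(X_{t^{-1}})\to C(X_t)$,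 $\alpha_t(f)(x)=f(\alpha_{t^{-1}}(x))$ for $x\in X_t$ (it is part of the setting that these are well-defined isomorphisms). An ideal $I$ of $C(X)$ is $\alpha$-invariant if $\alpha_g(I\cap C(X_{g^{-1}}))=I\cap C(X_g)$ for all $g\in G$, and $C(X)$ is $\alpha$-simple if its only $\alpha$-invariant ideals are $(0)$ and $C(X)$.
   Formalization: The equivalence of (i) with (ii) and (iii) is proved for compact Hausdorff X only, since it fails for arbitrary X (e.g. the integers acting on themselves by translation; the Sierpinski space with trivial group); (ii) and (iii) are proved equivalent for every X. *)

theory Defs
  imports "HOL-Analysis.Analysis" "HOL-Algebra.Ideal"
begin

locale topological_group = group G
  for G :: "('g, 'm) monoid_scheme" (structure) and T :: "'g topology" +
  assumes topspace_eq_carrier: "topspace T = carrier G"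
    and continuous_mult: "continuous_map (prod_topology T T) T (\<lambda>(s, t). s \<otimes> t)"
    and continuous_inv: "continuous_map T T (\<lambda>t. inv t)"

definition action_graph ::
    "('g, 'm) monoid_scheme \<Rightarrow> 'x topology \<Rightarrow> ('g \<Rightarrow> 'x set) \<Rightarrow> ('g \<times> 'x) set" where
  "action_graph G X D = {(t, x). t \<in> carrier G \<and> x \<in> topspace X \<and> x \<in> D (inv\<^bsub>G\<^esub> t)}"

(* D t is the open set X_t; the values of \<alpha> t outside D (inv t) are irrelevant. *)
locale partial_dynamical_system = topological_group G T
  for G :: "('g, 'm) monoid_scheme" (structure) and T :: "'g topology" +
  fixes X :: "'x topology" and D :: "'g \<Rightarrow> 'x set" and \<alpha> :: "'g \<Rightarrow> 'x \<Rightarrow> 'x"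
  assumes open_domain: "t \<in> carrier G \<Longrightarrow> openin X (D t)"
    and homeomorphic: "t \<in> carrier G \<Longrightarrow>
      homeomorphic_map (subtopology X (D (inv t))) (subtopology X (D t)) (\<alpha> t)"
    and domain_one: "D \<one> = topspace X"
    and action_one: "x \<in> topspace X \<Longrightarrow> \<alpha> \<one> x = x"
    and image_domain: "\<lbrakk>s \<in> carrier G; t \<in> carrier G\<rbrakk> \<Longrightarrow>
      \<alpha> t ` (D (inv t) \<inter> D s) = D t \<inter> D (t \<otimes> s)"
    and action_mult: "\<lbrakk>s \<in> carrier G; t \<in> carrier G; x \<in> \<alpha> (inv s) ` (D s \<inter> D (inv t))\<rbrakk> \<Longrightarrow>
      \<alpha> t (\<alpha> s x) = \<alpha> (t \<otimes> s) x"
    and open_graph: "openin (prod_topology T X) (action_graph G X D)"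
    and continuous_action:
      "continuous_map (subtopology (prod_topology T X) (action_graph G X D)) X (\<lambda>(t, x). \<alpha> t x)"

definition invariant_subset ::
    "('g, 'm) monoid_scheme \<Rightarrow> ('g \<Rightarrow> 'x set) \<Rightarrow> ('g \<Rightarrow> 'x \<Rightarrow> 'x) \<Rightarrow> 'x set \<Rightarrow> bool" where
  "invariant_subset G D \<alpha> Y \<longleftrightarrow>
     (\<forall>g\<in>carrier G. \<alpha> g ` (Y \<inter> D (inv\<^bsub>G\<^esub> g)) = Y \<inter> D g)"

definition partial_orbit ::
    "('g, 'm) monoid_scheme \<Rightarrow> ('g \<Rightarrow> 'x set) \<Rightarrow> ('g \<Rightarrow> 'x \<Rightarrow> 'x) \<Rightarrow> 'x \<Rightarrow> 'x set" where
  "partial_orbit G D \<alpha> x = {\<alpha> t x |t. t \<in> carrier G \<and> x \<in> D (inv\<^bsub>G\<^esub> t)}"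

definition minimal_system ::
    "('g, 'm) monoid_scheme \<Rightarrow> 'x topology \<Rightarrow> ('g \<Rightarrow> 'x set) \<Rightarrow> ('g \<Rightarrow> 'x \<Rightarrow> 'x) \<Rightarrow> bool" where
  "minimal_system G X D \<alpha> \<longleftrightarrow>
     (\<forall>x\<in>topspace X. X closure_of (partial_orbit G D \<alpha> x) = topspace X)"

(* Functions on X are represented by total functions that are undefined off topspace X,
   so that equality in the carrier is equality of functions on X. *)
definition continuous_functions :: "'x topology \<Rightarrow> ('x \<Rightarrow> complex) ring" where
  "continuous_functions X =
     \<lparr>carrier = {f \<in> extensional (topspace X). continuous_map X euclidean f},
      mult = (\<lambda>f g. \<lambda>x\<in>topspace X. f x * g x),
      one = (\<lambda>x\<in>topspace X. 1),
      zero = (\<lambda>x\<in>topspace X. 0),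
      add = (\<lambda>f g. \<lambda>x\<in>topspace X. f x + g x)\<rparr>"

lemma cring_continuous_functions: "cring (continuous_functions X)"
proof -
  let ?C = "continuous_functions X"
  have carrierI: "(\<lambda>x\<in>topspace X. f x) \<in> carrier ?C" if "continuous_map X euclidean f" for f
    using continuous_map_eq[OF that, of "\<lambda>x\<in>topspace X. f x"]
    by (simp add: continuous_functions_def)
  have const: "(\<lambda>x\<in>topspace X. c) \<in> carrier ?C" for c
    by (rule carrierI) simp
  have closed:
    "f \<oplus>\<^bsub>?C\<^esub> g \<in> carrier ?C" "f \<otimes>\<^bsub>?C\<^esub> g \<in> carrier ?C" "(\<lambda>x\<in>topspace X. - f x) \<in> carrier ?C"
    if "f \<in> carrier ?C" "g \<in> carrier ?C" for f g
  proof -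
    have "continuous_map X euclidean f" "continuous_map X euclidean g"
      using that by (auto simp: continuous_functions_def)
    then have "continuous_map X euclidean (\<lambda>x. f x + g x)"
        "continuous_map X euclidean (\<lambda>x. f x * g x)" "continuous_map X euclidean (\<lambda>x. - f x)"
      by (simp_all add: continuous_map_atin tendsto_add tendsto_mult tendsto_minus)
    from this[THEN carrierI] show
      "f \<oplus>\<^bsub>?C\<^esub> g \<in> carrier ?C" "f \<otimes>\<^bsub>?C\<^esub> g \<in> carrier ?C" "(\<lambda>x\<in>topspace X. - f x) \<in> carrier ?C"
      by (simp_all add: continuous_functions_def)
  qed
  have ext: "(\<lambda>x\<in>topspace X. f x) = f" if "f \<in> carrier ?C" for f
    using that by (simp add: continuous_functions_def extensional_restrict)
  have neg: "\<exists>h\<in>carrier ?C. h \<oplus>\<^bsub>?C\<^esub> f = \<zero>\<^bsub>?C\<^esub>" if "f \<in> carrier ?C" for f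
    by (rule bexI[OF _ closed(3)[OF that that]])
      (auto simp: continuous_functions_def intro: restrict_ext)
  have ops: "f \<oplus>\<^bsub>?C\<^esub> g = (\<lambda>x\<in>topspace X. f x + g x)" "f \<otimes>\<^bsub>?C\<^esub> g = (\<lambda>x\<in>topspace X. f x * g x)"
    "\<one>\<^bsub>?C\<^esub> = (\<lambda>x\<in>topspace X. 1)" "\<zero>\<^bsub>?C\<^esub> = (\<lambda>x\<in>topspace X. 0)" for f g
    by (simp_all add: continuous_functions_def)
  show ?thesis
    by (intro cringI abelian_groupI comm_monoidI neg closed)
      (auto simp: ops const ext algebra_simps cong: restrict_cong)
qed

definition functions_on :: "'x topology \<Rightarrow> 'x set \<Rightarrow> ('x \<Rightarrow> complex) set" where
  "functions_on X Y =
     {f \<in> carrier (continuous_functions X). \<forall>x\<in>topspace X - Y. f x = 0}"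

(* The induced map C(X_{t^{-1}}) \<rightarrow> C(X_t): the formula for \<alpha>_t(f) on X_t, extended by zero. *)
definition induced_action ::
    "('g, 'm) monoid_scheme \<Rightarrow> 'x topology \<Rightarrow> ('g \<Rightarrow> 'x set) \<Rightarrow> ('g \<Rightarrow> 'x \<Rightarrow> 'x) \<Rightarrow>
     'g \<Rightarrow> ('x \<Rightarrow> complex) \<Rightarrow> ('x \<Rightarrow> complex)" where
  "induced_action G X D \<alpha> t f =
     (\<lambda>x\<in>topspace X. if x \<in> D t then f (\<alpha> (inv\<^bsub>G\<^esub> t) x) else 0)"

definition invariant_ideal ::
    "('g, 'm) monoid_scheme \<Rightarrow> 'x topology \<Rightarrow> ('g \<Rightarrow> 'x set) \<Rightarrow> ('g \<Rightarrow> 'x \<Rightarrow> 'x) \<Rightarrow>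
     ('x \<Rightarrow> complex) set \<Rightarrow> bool" where
  "invariant_ideal G X D \<alpha> I \<longleftrightarrow>
     ideal I (continuous_functions X) \<and>
     (\<forall>g\<in>carrier G. induced_action G X D \<alpha> g ` (I \<inter> functions_on X (D (inv\<^bsub>G\<^esub> g)))
        = I \<inter> functions_on X (D g))"

definition action_simple ::
    "('g, 'm) monoid_scheme \<Rightarrow> 'x topology \<Rightarrow> ('g \<Rightarrow> 'x set) \<Rightarrow> ('g \<Rightarrow> 'x \<Rightarrow> 'x) \<Rightarrow> bool" where
  "action_simple G X D \<alpha> \<longleftrightarrow>
     (\<forall>I. invariant_ideal G X D \<alpha> I \<longrightarrow>
        I = {\<zero>\<^bsub>continuous_functions X\<^esub>} \<or> I = carrier (continuous_functions X))"

end

theory Submission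
  imports Defs
begin

text \<open>Minimality is compared with closed invariant sets through orbit closures, which are invariant.
  For compact Hausdorff \<open>X\<close>, a closed invariant set yields the invariant ideal of functions vanishing
  on it, and an ideal yields its set of common zeros \<open>Y\<close>. Cutting off with Urysohn functions supported
  in \<open>X\<^sub>g\<close> shows that \<open>Y\<close> is invariant when the ideal is. Ideals need not be closed, but if
  \<open>Y\<close> is empty then by compactness a finite sum of terms \<open>cnj f * f\<close> is an invertible element of
  the ideal.\<close>

section \<open>Ideals of the ring of continuous functions\<close>

lemma restrict_in_carrier_continuous_functions:
  assumes "continuous_map X euclidean f"
  shows "(\<lambda>x\<in>topspace X. f x) \<in> carrier (continuous_functions X)"
  using continuous_map_eq[OF assms, of "\<lambda>x\<in>topspace X. f x"]
  by (simp add: continuous_functions_def)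

lemma continuous_functions_eqI:
  assumes "f \<in> carrier (continuous_functions X)" "g \<in> carrier (continuous_functions X)"
    and "\<And>x. x \<in> topspace X \<Longrightarrow> f x = g x"
  shows "f = g"
  using assms by (auto simp: continuous_functions_def intro: extensionalityI)

text \<open>Restricting \<open>h\<close> turns it into a ring element, so conjugates, inverses and
  Urysohn functions can serve as multipliers without being extensional themselves.\<close>

lemma restrict_mult_in_ideal:
  assumes "ideal I (continuous_functions X)" "f \<in> I" "continuous_map X euclidean h"
  shows "(\<lambda>x\<in>topspace X. h x * f x) \<in> I"
proof -
  have "(\<lambda>x\<in>topspace X. h x) \<otimes>\<^bsub>continuous_functions X\<^esub> f \<in> I"
    using assms restrict_in_carrier_continuous_functions ideal.I_l_closed by metis
  then show ?thesis
    by (simp add: continuous_functions_def cong: restrict_cong)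
qed

lemma ideal_memD:
  assumes "ideal I (continuous_functions X)" "f \<in> I"
  shows "f \<in> carrier (continuous_functions X)" "continuous_map X euclidean f"
proof -
  show "f \<in> carrier (continuous_functions X)"
    using assms additive_subgroup.a_Hcarr ideal.axioms(1) by metis
  then show "continuous_map X euclidean f"
    by (simp add: continuous_functions_def)
qed

text \<open>Each summand is the multiple \<open>cnj (f x) * f x\<close> of a member of the ideal.
  Since the summands are nonnegative reals, no cancellation occurs: the sum vanishes only at common
  zeros of the chosen functions.\<close>

lemma sum_norm_squares_in_ideal:
  assumes I: "ideal I (continuous_functions X)" and "finite F" and "f ` F \<subseteq> I"
  shows "(\<lambda>y\<in>topspace X. \<Sum>x\<in>F. complex_of_real ((cmod (f x y))\<^sup>2)) \<in> I"
  using assms(2,3)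
proof (induction F)
  case empty
  have "\<zero>\<^bsub>continuous_functions X\<^esub> \<in> I"
    by (rule additive_subgroup.zero_closed[OF ideal.axioms(1)[OF I]])
  moreover have "\<zero>\<^bsub>continuous_functions X\<^esub> = (\<lambda>y\<in>topspace X. 0)"
    by (simp add: continuous_functions_def)
  ultimately show ?case by (simp only: sum.empty)
next
  case (insert a F)
  let ?S = "\<lambda>F. \<lambda>y\<in>topspace X. \<Sum>x\<in>F. complex_of_real ((cmod (f x y))\<^sup>2)"
  have "f a \<in> I" using insert.prems by auto
  moreover from this have "continuous_map X euclidean (\<lambda>y. cnj (f a y))"
    using ideal_memD(2)[OF I] by (simp add: continuous_map_atin tendsto_cnj)
  ultimately have "(\<lambda>y\<in>topspace X. cnj (f a y) * f a y) \<in> I"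
    by (rule restrict_mult_in_ideal[OF I])
  moreover have "?S F \<in> I"
    using insert.prems by (intro insert.IH) auto
  ultimately have "(\<lambda>y\<in>topspace X. cnj (f a y) * f a y) \<oplus>\<^bsub>continuous_functions X\<^esub> ?S F \<in> I"
    by (rule additive_subgroup.a_closed[OF ideal.axioms(1)[OF I]])
  moreover have "(\<lambda>y\<in>topspace X. cnj (f a y) * f a y) \<oplus>\<^bsub>continuous_functions X\<^esub> ?S F
      = ?S (insert a F)"
  proof -
    have "cnj (f a y) * f a y = complex_of_real ((cmod (f a y))\<^sup>2)" for y
      by (simp only: complex_norm_square mult.commute[of "cnj (f a y)"])
    then show ?thesis
      using insert.hyps by (simp add: continuous_functions_def cong: restrict_cong)
  qed
  ultimately show ?case by (simp only:)
qed

text \<open>Each point has a neighbourhood on which some member of \<open>I\<close> is nowhere zero.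
  Finitely many of these cover \<open>X\<close>, so the corresponding sum of squared moduli is
  nowhere zero; multiplying it by its continuous reciprocal puts the unit into
  \<open>I\<close>.\<close>

lemma ideal_eq_carrier_if_no_common_zero:
  assumes I: "ideal I (continuous_functions X)" and "compact_space X"
    and nz: "\<And>x. x \<in> topspace X \<Longrightarrow> \<exists>f\<in>I. f x \<noteq> 0"
  shows "I = carrier (continuous_functions X)"
proof -
  obtain f where f: "\<And>x. x \<in> topspace X \<Longrightarrow> f x \<in> I \<and> f x x \<noteq> 0"
    using nz by metis
  define U where "U x = {y \<in> topspace X. f x y \<in> - {0}}" for x
  have U: "openin X (U x)" if "x \<in> topspace X" for x
    unfolding U_def
    by (rule openin_continuous_map_preimage[of _ euclidean])
      (use that f ideal_memD(2)[OF I] in auto)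
  have cover: "topspace X \<subseteq> \<Union> (U ` topspace X)"
    using f by (auto simp: U_def)
  have "\<exists>\<F>. finite \<F> \<and> \<F> \<subseteq> U ` topspace X \<and> topspace X \<subseteq> \<Union> \<F>"
    using \<open>compact_space X\<close> unfolding compact_space_def
    by (rule compactinD) (use U cover in auto)
  then obtain F where F: "finite F" "F \<subseteq> topspace X" "topspace X \<subseteq> \<Union> (U ` F)"
    unfolding ex_finite_subset_image by blast
  define s where "s = (\<lambda>y\<in>topspace X. \<Sum>x\<in>F. complex_of_real ((cmod (f x y))\<^sup>2))"
  have s: "s \<in> I"
    unfolding s_def using F f by (intro sum_norm_squares_in_ideal[OF I]) auto
  have nonzero: "s y \<noteq> 0" if y: "y \<in> topspace X" for y
  proof -
    obtain x where "x \<in> F" "f x y \<noteq> 0"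
      using F y by (auto simp: U_def)
    then have "(\<Sum>x\<in>F. (cmod (f x y))\<^sup>2) > 0"
      using F by (intro sum_pos2[of _ x]) auto
    moreover have "s y = complex_of_real (\<Sum>x\<in>F. (cmod (f x y))\<^sup>2)"
      using y by (simp add: s_def)
    ultimately show ?thesis
      by (simp only: of_real_eq_0_iff)
  qed
  have "continuous_map X euclidean (\<lambda>y. inverse (s y))"
    using ideal_memD(2)[OF I s] nonzero by (simp add: continuous_map_atin tendsto_inverse)
  then have "(\<lambda>y\<in>topspace X. inverse (s y) * s y) \<in> I"
    by (rule restrict_mult_in_ideal[OF I s])
  moreover have "(\<lambda>y\<in>topspace X. inverse (s y) * s y) = \<one>\<^bsub>continuous_functions X\<^esub>"
    using nonzero by (simp add: continuous_functions_def cong: restrict_cong)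
  ultimately show ?thesis
    by (intro ideal.one_imp_carrier[OF I]) (simp only:)
qed

lemma ideal_vanishing_functions:
  assumes "Y \<subseteq> topspace X"
  shows "ideal {f \<in> carrier (continuous_functions X). \<forall>y\<in>Y. f y = 0} (continuous_functions X)"
proof (rule idealI)
  interpret cring "continuous_functions X" by (rule cring_continuous_functions)
  let ?I = "{f \<in> carrier (continuous_functions X). \<forall>y\<in>Y. f y = 0}"
  show "ring (continuous_functions X)" by (rule ring_axioms)
  have zero: "\<zero>\<^bsub>continuous_functions X\<^esub> y = 0" if "y \<in> Y" for y
    using that assms by (auto simp: continuous_functions_def)
  have add: "(f \<oplus>\<^bsub>continuous_functions X\<^esub> g) y = f y + g y" if "y \<in> Y" for f g y
    using that assms by (auto simp: continuous_functions_def)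
  have mult: "(f \<otimes>\<^bsub>continuous_functions X\<^esub> g) y = f y * g y" if "y \<in> Y" for f g y
    using that assms by (auto simp: continuous_functions_def)
  \<comment> \<open>The additive inverse is only known abstractly in the ring, so its value at
    \<open>y\<close> is read off from \<open>f\<close> plus its inverse being zero.\<close>
  have minus: "(\<ominus>\<^bsub>continuous_functions X\<^esub> f) y = 0" if "y \<in> Y" "f \<in> ?I" for f y
    using that add[of y f "\<ominus>\<^bsub>continuous_functions X\<^esub> f"] zero by (simp add: r_neg)
  show "subgroup ?I (add_monoid (continuous_functions X))"
    by (rule add.subgroupI) (auto simp: add minus zero)
  show "h \<otimes>\<^bsub>continuous_functions X\<^esub> f \<in> ?I" "f \<otimes>\<^bsub>continuous_functions X\<^esub> h \<in> ?I"
    if "f \<in> ?I" "h \<in> carrier (continuous_functions X)" for f h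
    using that by (auto simp: mult)
qed

text \<open>Compact Hausdorff spaces are completely regular. The bumps serve to localize functions
  to the sets \<open>D g\<close> and to find nonzero functions vanishing on a proper closed
  set.\<close>

lemma Urysohn_bump:
  assumes "compact_space X" "Hausdorff_space X" "openin X U" "x \<in> U"
  obtains h :: "'x \<Rightarrow> complex"
  where "continuous_map X euclidean h" "h x = 1" "\<And>y. y \<in> topspace X - U \<Longrightarrow> h y = 0"
proof -
  have "completely_regular_space X"
    using assms compact_Hausdorff_or_regular_imp_normal_space normal_imp_completely_regular_space
    by blast
  then obtain f :: "'x \<Rightarrow> real"
    where f: "continuous_map X euclidean f" "f x = 0" "f ` (topspace X - U) \<subseteq> {1}"
    using assms unfolding completely_regular_space_alt' by blast
  \<comment> \<open>Complete regularity yields 0 at \<open>x\<close> and 1 off \<open>U\<close>; the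
    bump is the complementary function.\<close>
  have "continuous_map X euclidean (\<lambda>y. complex_of_real (1 - f y))"
    using f(1) by (simp add: continuous_map_atin tendsto_of_real tendsto_diff del: of_real_diff)
  with f show ?thesis
    by (intro that[of "\<lambda>y. complex_of_real (1 - f y)"]) auto
qed

context partial_dynamical_system
begin

section \<open>Elementary properties of the partial action and of invariant sets\<close>

lemma domain_subset: "t \<in> carrier G \<Longrightarrow> D t \<subseteq> topspace X"
  using open_domain openin_subset by blast

lemma image_action: "t \<in> carrier G \<Longrightarrow> \<alpha> t ` D (inv t) = D t"
  using homeomorphic_imp_surjective_map[OF homeomorphic] domain_subset
  by (metis inv_closed topspace_subtopology_subset)

lemma action_in_domain: "\<lbrakk>t \<in> carrier G; x \<in> D (inv t)\<rbrakk> \<Longrightarrow> \<alpha> t x \<in> D t"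
  using image_action by blast

lemma action_inverse:
  assumes "t \<in> carrier G" "x \<in> D (inv t)"
  shows "\<alpha> (inv t) (\<alpha> t x) = x"
proof -
  \<comment> \<open>This is the domain condition of \<open>action_mult\<close> for the product of
    \<open>inv t\<close> and \<open>t\<close>; the image in question is all of
    \<open>D (inv t)\<close>.\<close>
  have "x \<in> \<alpha> (inv t) ` (D t \<inter> D (inv (inv t)))"
    using assms image_action[of "inv t"] by simp
  then have "\<alpha> (inv t) (\<alpha> t x) = \<alpha> (inv t \<otimes> t) x"
    using assms by (intro action_mult) auto
  then show ?thesis
    using assms domain_subset[of "inv t"] action_one by (auto simp: l_inv)
qed

lemma action_inverse':
  assumes "t \<in> carrier G" "x \<in> D t"
  shows "\<alpha> t (\<alpha> (inv t) x) = x"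
  using action_inverse[of "inv t" x] assms by simp

lemma continuous_map_action:
  assumes "t \<in> carrier G"
  shows "continuous_map (subtopology X (D (inv t))) X (\<alpha> t)"
  using homeomorphic_imp_continuous_map[OF homeomorphic[OF assms]] continuous_map_in_subtopology
  by blast

text \<open>One inclusion for all group elements suffices: applied to \<open>inv g\<close>, it
  provides the preimages required for the reverse inclusion at \<open>g\<close>.\<close>

lemma invariant_subsetI:
  assumes "\<And>g y. \<lbrakk>g \<in> carrier G; y \<in> Y; y \<in> D (inv g)\<rbrakk> \<Longrightarrow> \<alpha> g y \<in> Y"
  shows "invariant_subset G D \<alpha> Y"
  unfolding invariant_subset_def
proof (intro ballI equalityI subsetI)
  fix g y assume g: "g \<in> carrier G"
  {
    assume "y \<in> \<alpha> g ` (Y \<inter> D (inv g))"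
    then show "y \<in> Y \<inter> D g" using g assms action_in_domain by auto
  next
    assume y: "y \<in> Y \<inter> D g"
    then have "\<alpha> (inv g) y \<in> Y \<inter> D (inv g)"
      using g assms[of "inv g" y] action_in_domain[of "inv g" y] by auto
    moreover have "y = \<alpha> g (\<alpha> (inv g) y)"
      using g y action_inverse' by auto
    ultimately show "y \<in> \<alpha> g ` (Y \<inter> D (inv g))" by blast
  }
qed

lemma invariant_subsetD:
  assumes "invariant_subset G D \<alpha> Y" "g \<in> carrier G" "y \<in> Y" "y \<in> D (inv g)"
  shows "\<alpha> g y \<in> Y"
  using assms unfolding invariant_subset_def by blast

section \<open>Partial orbits, their closures and minimality\<close>

lemma partial_orbit_subset:
  "\<lbrakk>invariant_subset G D \<alpha> Y; x \<in> Y\<rbrakk> \<Longrightarrow> partial_orbit G D \<alpha> x \<subseteq> Y"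
  by (auto simp: partial_orbit_def intro: invariant_subsetD)

lemma self_in_partial_orbit:
  assumes "x \<in> topspace X"
  shows "x \<in> partial_orbit G D \<alpha> x"
  unfolding partial_orbit_def
  using assms action_one domain_one by (auto intro!: exI[of _ \<one>])

lemma partial_orbit_in_topspace: "partial_orbit G D \<alpha> x \<subseteq> topspace X"
  using action_in_domain domain_subset by (fastforce simp: partial_orbit_def)

text \<open>Writing \<open>y = \<alpha> s x\<close>, the new point is
  \<open>\<alpha> (g \<otimes> s) x\<close>; what needs proof is that \<open>x\<close> lies in the
  domain of the product.\<close>

lemma action_in_partial_orbit:
  assumes g: "g \<in> carrier G" and y: "y \<in> partial_orbit G D \<alpha> x" "y \<in> D (inv g)"
  shows "\<alpha> g y \<in> partial_orbit G D \<alpha> x"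
proof -
  obtain s where s: "s \<in> carrier G" "x \<in> D (inv s)" "y = \<alpha> s x"
    using y by (auto simp: partial_orbit_def)
  have "y \<in> D s \<inter> D (inv g)" "x = \<alpha> (inv s) y"
    using s y action_in_domain action_inverse by auto
  then have x: "x \<in> \<alpha> (inv s) ` (D s \<inter> D (inv g))"
    by blast
  \<comment> \<open>This image lies in the domain wanted, because
    \<open>inv s \<otimes> inv g = inv (g \<otimes> s)\<close>.\<close>
  have "\<alpha> (inv s) ` (D (inv (inv s)) \<inter> D (inv g)) = D (inv s) \<inter> D (inv s \<otimes> inv g)"
    using s g by (intro image_domain) auto
  then have "x \<in> D (inv (g \<otimes> s))"
    using x s g by (simp add: inv_mult_group)
  moreover have "\<alpha> g y = \<alpha> (g \<otimes> s) x"
    using action_mult[OF s(1) g x] s by simp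
  ultimately show ?thesis
    using s g unfolding partial_orbit_def by blast
qed

text \<open>The preimage under \<open>\<alpha> g\<close> of a neighbourhood \<open>V\<close> of
  \<open>\<alpha> g y\<close> is open in \<open>D (inv g)\<close>, hence open in \<open>X\<close>
  because the domain is open. It therefore meets \<open>Y\<close>, and a common point is sent into
  both \<open>Y\<close> and \<open>V\<close>.\<close>

lemma invariant_subset_closure_of:
  assumes inv: "\<And>g y. \<lbrakk>g \<in> carrier G; y \<in> Y; y \<in> D (inv g)\<rbrakk> \<Longrightarrow> \<alpha> g y \<in> Y"
  shows "invariant_subset G D \<alpha> (X closure_of Y)"
proof (rule invariant_subsetI)
  fix g y assume g: "g \<in> carrier G" and y: "y \<in> X closure_of Y" "y \<in> D (inv g)"
  show "\<alpha> g y \<in> X closure_of Y"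
    unfolding in_closure_of
  proof (intro conjI allI impI)
    show "\<alpha> g y \<in> topspace X"
      using g y action_in_domain domain_subset by blast
    fix V assume V: "\<alpha> g y \<in> V \<and> openin X V"
    let ?W = "{z \<in> topspace (subtopology X (D (inv g))). \<alpha> g z \<in> V}"
    have "openin (subtopology X (D (inv g))) ?W"
      by (rule openin_continuous_map_preimage[OF continuous_map_action[OF g]]) (use V in simp)
    then have "openin X ?W"
      by (rule openin_trans_full[OF _ open_domain]) (use g in simp)
    moreover have "y \<in> ?W"
      using V y g domain_subset[of "inv g"] by auto
    ultimately obtain z where z: "z \<in> Y" "z \<in> ?W"
      using y(1) unfolding in_closure_of by meson
    then have "\<alpha> g z \<in> Y"
      by (intro inv[OF g]) auto
    with z show "\<exists>z. z \<in> Y \<and> z \<in> V"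
      by blast
  qed
qed

text \<open>The closure of the orbit of \<open>x\<close> is the smallest closed invariant set
  containing \<open>x\<close>, which settles both directions.\<close>

lemma minimal_system_iff:
  "minimal_system G X D \<alpha> \<longleftrightarrow>
   \<not> (\<exists>Y. closedin X Y \<and> invariant_subset G D \<alpha> Y \<and> Y \<noteq> {} \<and> Y \<noteq> topspace X)"
proof
  assume min: "minimal_system G X D \<alpha>"
  show "\<not> (\<exists>Y. closedin X Y \<and> invariant_subset G D \<alpha> Y \<and> Y \<noteq> {} \<and> Y \<noteq> topspace X)"
  proof
    assume "\<exists>Y. closedin X Y \<and> invariant_subset G D \<alpha> Y \<and> Y \<noteq> {} \<and> Y \<noteq> topspace X"
    then obtain Y x where Y: "closedin X Y" "invariant_subset G D \<alpha> Y" "x \<in> Y" "Y \<noteq> topspace X"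
      by blast
    then have "X closure_of (partial_orbit G D \<alpha> x) \<subseteq> Y"
      by (intro closure_of_minimal partial_orbit_subset)
    moreover have sub: "Y \<subseteq> topspace X"
      using Y(1) by (rule closedin_subset)
    moreover have "X closure_of (partial_orbit G D \<alpha> x) = topspace X"
      using min sub Y(3) unfolding minimal_system_def by auto
    ultimately show False
      using Y(4) by simp
  qed
next
  assume *: "\<not> (\<exists>Y. closedin X Y \<and> invariant_subset G D \<alpha> Y \<and> Y \<noteq> {} \<and> Y \<noteq> topspace X)"
  show "minimal_system G X D \<alpha>"
    unfolding minimal_system_def
  proof
    fix x assume "x \<in> topspace X"
    then have "x \<in> X closure_of (partial_orbit G D \<alpha> x)"
      using self_in_partial_orbit closure_of_subset[OF partial_orbit_in_topspace] by auto
    moreover have "invariant_subset G D \<alpha> (X closure_of (partial_orbit G D \<alpha> x))"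
      by (intro invariant_subset_closure_of action_in_partial_orbit)
    ultimately show "X closure_of (partial_orbit G D \<alpha> x) = topspace X"
      using * closedin_closure_of[of X "partial_orbit G D \<alpha> x"] by auto
  qed
qed

section \<open>The induced action on functions\<close>

text \<open>The extension by zero is continuous because the set where a function in \<open>C(X\<^sub>s)\<close>,
  \<open>s = t\<^sup>-\<^sup>1\<close>, avoids a neighbourhood of \<open>0\<close> is a compact subset of \<open>X\<^sub>s\<close>, so its image under
  \<open>\<alpha>\<^sub>t\<close> is closed in \<open>X\<close>.\<close>

lemma induced_action_in_functions_on:
  assumes compact: "compact_space X" and Hausdorff: "Hausdorff_space X"
    and t: "t \<in> carrier G" and f: "f \<in> functions_on X (D (inv t))"
  shows "induced_action G X D \<alpha> t f \<in> functions_on X (D t)"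
proof -
  let ?F = "induced_action G X D \<alpha> t f"
  have cont: "continuous_map X euclidean f"
    using f by (simp add: functions_on_def continuous_functions_def)
  have "openin X {x \<in> topspace X. ?F x \<in> U}" if U: "open U" for U
  \<comment> \<open>The extension has value 0 off \<open>D t\<close>. If \<open>0 \<in> U\<close>,
    the preimage of \<open>U\<close> contains everything off \<open>D t\<close> and is treated
    through its complement, the image of a compact set. Otherwise it lies inside the open set
    \<open>D t\<close>, where continuity of the composition suffices.\<close>
  proof (cases "0 \<in> U")
    case True
    let ?K = "{z \<in> topspace X. f z \<in> - U}"
    have "closedin X ?K"
      by (rule closedin_continuous_map_preimage[OF cont]) (use U in auto)
    then have "compactin X ?K"
      by (rule closedin_compact_space[OF compact])
    moreover have K: "?K \<subseteq> D (inv t)"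
      using f True unfolding functions_on_def by force
    ultimately have "compactin (subtopology X (D (inv t))) ?K"
      by (simp add: compactin_subtopology)
    then have "closedin X (\<alpha> t ` ?K)"
      by (rule compactin_imp_closedin[OF Hausdorff image_compactin[OF _ continuous_map_action[OF t]]])
    moreover have "{x \<in> topspace X. ?F x \<in> U} = topspace X - \<alpha> t ` ?K"
    proof (intro equalityI subsetI)
      fix x assume x: "x \<in> {x \<in> topspace X. ?F x \<in> U}"
      show "x \<in> topspace X - \<alpha> t ` ?K"
      proof
        show "x \<in> topspace X" using x by simp
        show "x \<notin> \<alpha> t ` ?K"
        proof
          assume "x \<in> \<alpha> t ` ?K"
          then obtain z where z: "z \<in> ?K" "x = \<alpha> t z" by blast
          then have "?F x = f z"
            using K t x action_in_domain action_inverse by (auto simp: induced_action_def)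
          then show False using x z by auto
        qed
      qed
    next
      fix x assume x: "x \<in> topspace X - \<alpha> t ` ?K"
      show "x \<in> {x \<in> topspace X. ?F x \<in> U}"
      proof (cases "x \<in> D t")
        case True
        then have "\<alpha> (inv t) x \<in> topspace X" "x = \<alpha> t (\<alpha> (inv t) x)"
          using t action_in_domain[of "inv t" x] domain_subset[of "inv t"] action_inverse' by auto
        then have "f (\<alpha> (inv t) x) \<in> U"
          using x by blast
        then show ?thesis
          using x True by (simp add: induced_action_def)
      qed (use x \<open>0 \<in> U\<close> in \<open>auto simp: induced_action_def\<close>)
    qed
    ultimately show ?thesis by auto
  next
    case False
    have "continuous_map (subtopology X (D t)) euclidean (f \<circ> \<alpha> (inv t))"
      using continuous_map_compose[OF continuous_map_action[of "inv t"] cont] t by simp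
    then have "openin (subtopology X (D t))
        {x \<in> topspace (subtopology X (D t)). (f \<circ> \<alpha> (inv t)) x \<in> U}"
      by (rule openin_continuous_map_preimage) (use U in auto)
    moreover have "{x \<in> topspace (subtopology X (D t)). (f \<circ> \<alpha> (inv t)) x \<in> U}
        = {x \<in> topspace X. ?F x \<in> U}"
      using False by (auto simp: induced_action_def)
    ultimately show ?thesis
      using t open_domain openin_trans_full by metis
  qed
  then have "continuous_map X euclidean ?F"
    by (simp add: continuous_map)
  then show ?thesis
    by (auto simp: functions_on_def continuous_functions_def induced_action_def)
qed

lemma induced_action_apply:
  assumes "t \<in> carrier G" "x \<in> D t"
  shows "induced_action G X D \<alpha> t f x = f (\<alpha> (inv t) x)"
  using assms domain_subset by (auto simp: induced_action_def)

text \<open>Supplies the preimages that turn preservation of an ideal under all group elements into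
  the equality demanded by \<open>invariant_ideal\<close>.\<close>

lemma induced_action_inverse:
  assumes t: "t \<in> carrier G" and f: "f \<in> functions_on X (D t)"
  shows "induced_action G X D \<alpha> t (induced_action G X D \<alpha> (inv t) f) = f"
proof
  fix x
  show "induced_action G X D \<alpha> t (induced_action G X D \<alpha> (inv t) f) x = f x"
  proof (cases "x \<in> D t")
    case True
    then show ?thesis
      using t action_in_domain[of "inv t" x]
      by (simp add: induced_action_apply action_inverse')
  next
    case False
    then show ?thesis
      \<comment> \<open>Off \<open>D t\<close> both sides are 0 at points of \<open>X\<close> and
        \<open>undefined\<close> elsewhere.\<close>
      using f by (auto simp: induced_action_def functions_on_def continuous_functions_def
          extensional_def)
  qed
qed

section \<open>Invariant ideals and closed invariant sets\<close>

text \<open>At a point \<open>y\<close> of \<open>Y\<close> in \<open>D g\<close> the transported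
  function takes the value of \<open>f\<close> at \<open>\<alpha> (inv g) y\<close>, again a point
  of \<open>Y\<close>; at other points of \<open>Y\<close> it is 0 by extension. Using
  \<open>inv g\<close> as well gives surjectivity.\<close>

lemma invariant_ideal_vanishing_functions:
  assumes "compact_space X" "Hausdorff_space X"
    and Y: "Y \<subseteq> topspace X" "invariant_subset G D \<alpha> Y"
  shows "invariant_ideal G X D \<alpha> {f \<in> carrier (continuous_functions X). \<forall>y\<in>Y. f y = 0}"
    (is "invariant_ideal G X D \<alpha> ?I")
proof -
  have mem: "induced_action G X D \<alpha> g f \<in> ?I \<inter> functions_on X (D g)"
    if g: "g \<in> carrier G" and f: "f \<in> ?I \<inter> functions_on X (D (inv g))" for g f
  proof -
    have "induced_action G X D \<alpha> g f \<in> functions_on X (D g)"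
      using assms g f induced_action_in_functions_on by blast
    moreover have "induced_action G X D \<alpha> g f y = 0" if y: "y \<in> Y" for y
    proof (cases "y \<in> D g")
      case True
      then have "\<alpha> (inv g) y \<in> Y"
        using Y(2) g y invariant_subsetD[of Y "inv g" y] by simp
      then show ?thesis
        using f g True by (simp add: induced_action_apply)
    next
      case False
      then show ?thesis
        using y Y by (auto simp: induced_action_def)
    qed
    ultimately show ?thesis
      by (simp add: functions_on_def)
  qed
  have "induced_action G X D \<alpha> g ` (?I \<inter> functions_on X (D (inv g))) = ?I \<inter> functions_on X (D g)"
    if g: "g \<in> carrier G" for g
  proof (intro equalityI subsetI)
    fix f assume f: "f \<in> ?I \<inter> functions_on X (D g)"
    then have "induced_action G X D \<alpha> (inv g) f \<in> ?I \<inter> functions_on X (D (inv g))"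
      using mem[of "inv g" f] g by simp
    moreover have "f = induced_action G X D \<alpha> g (induced_action G X D \<alpha> (inv g) f)"
      using f g induced_action_inverse by auto
    ultimately show "f \<in> induced_action G X D \<alpha> g ` (?I \<inter> functions_on X (D (inv g)))"
      by blast
  qed (use mem[OF g] in blast)
  then show ?thesis
    using ideal_vanishing_functions[OF Y(1)] by (simp add: invariant_ideal_def)
qed

text \<open>A member \<open>f\<close> of \<open>I\<close> need not vanish off \<open>D g\<close>, so
  invariance cannot be applied to it directly. Its product with a bump at
  \<open>\<alpha> g x\<close> does vanish there and hence is transported from some \<open>k\<close>
  in \<open>I\<close>; comparing values at \<open>\<alpha> g x\<close> gives
  \<open>f (\<alpha> g x) = k x = 0\<close>.\<close>

lemma invariant_subset_common_zeros:
  assumes "compact_space X" "Hausdorff_space X" and I: "invariant_ideal G X D \<alpha> I"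
  shows "invariant_subset G D \<alpha> {x \<in> topspace X. \<forall>f\<in>I. f x = 0}"
proof (rule invariant_subsetI)
  fix g x
  assume g: "g \<in> carrier G" and x: "x \<in> {x \<in> topspace X. \<forall>f\<in>I. f x = 0}" "x \<in> D (inv g)"
  have gx: "\<alpha> g x \<in> D g"
    using g x action_in_domain by blast
  have "f (\<alpha> g x) = 0" if f: "f \<in> I" for f
  proof -
    obtain h where h: "continuous_map X euclidean h" "h (\<alpha> g x) = 1"
        "\<And>y. y \<in> topspace X - D g \<Longrightarrow> h y = (0::complex)"
      using Urysohn_bump[OF assms(1,2) open_domain[OF g] gx] by blast
    let ?k = "\<lambda>y\<in>topspace X. h y * f y"
    have ideal: "ideal I (continuous_functions X)"
      using I by (simp add: invariant_ideal_def)
    have "?k \<in> I"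
      using ideal f h(1) by (rule restrict_mult_in_ideal)
    moreover from this have "?k \<in> functions_on X (D g)"
      using ideal_memD(1)[OF ideal] h(3) by (simp add: functions_on_def)
    ultimately have "?k \<in> induced_action G X D \<alpha> g ` (I \<inter> functions_on X (D (inv g)))"
      using I g unfolding invariant_ideal_def by blast
    then obtain k where k: "k \<in> I" "?k = induced_action G X D \<alpha> g k"
      by blast
    have "?k (\<alpha> g x) = k x"
      unfolding k(2) using g gx x(2) by (simp add: induced_action_apply action_inverse)
    moreover have "k x = 0"
      using k(1) x(1) by blast
    moreover have "\<alpha> g x \<in> topspace X"
      using gx g domain_subset by blast
    ultimately show ?thesis
      using h(2) by simp
  qed
  then show "\<alpha> g x \<in> {x \<in> topspace X. \<forall>f\<in>I. f x = 0}"
    using gx g domain_subset by auto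
qed

lemma closedin_common_zeros:
  assumes "ideal I (continuous_functions X)"
  shows "closedin X {x \<in> topspace X. \<forall>f\<in>I. f x = 0}"
proof -
  have "closedin X {x \<in> topspace X. f x \<in> {0}}" if "f \<in> I" for f
    by (rule closedin_continuous_map_preimage[OF ideal_memD(2)[OF assms that]]) auto
  \<comment> \<open>\<open>closedin_Inter\<close> asks for a nonempty family, hence the case split;
    the factor \<open>topspace X\<close> gives the empty intersection its proper value.\<close>
  then have "closedin X (topspace X \<inter> \<Inter> ((\<lambda>f. {x \<in> topspace X. f x \<in> {0}}) ` I))"
    by (cases "I = {}") (auto intro!: closedin_Inter closedin_Int)
  moreover have "topspace X \<inter> \<Inter> ((\<lambda>f. {x \<in> topspace X. f x \<in> {0}}) ` I)
      = {x \<in> topspace X. \<forall>f\<in>I. f x = 0}"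
    by auto
  ultimately show ?thesis by simp
qed

text \<open>For a proper nonempty closed invariant \<open>Y\<close>, the vanishing ideal is nonzero
  by a bump at a point outside \<open>Y\<close> and proper because the unit vanishes nowhere.
  Conversely, the common zeros of an invariant ideal are none or all of \<open>X\<close>, making the
  ideal the whole ring or zero.\<close>

lemma action_simple_iff:
  assumes "compact_space X" "Hausdorff_space X"
  shows "action_simple G X D \<alpha> \<longleftrightarrow>
   \<not> (\<exists>Y. closedin X Y \<and> invariant_subset G D \<alpha> Y \<and> Y \<noteq> {} \<and> Y \<noteq> topspace X)"
proof
  assume simple: "action_simple G X D \<alpha>"
  show "\<not> (\<exists>Y. closedin X Y \<and> invariant_subset G D \<alpha> Y \<and> Y \<noteq> {} \<and> Y \<noteq> topspace X)"
  proof
    assume "\<exists>Y. closedin X Y \<and> invariant_subset G D \<alpha> Y \<and> Y \<noteq> {} \<and> Y \<noteq> topspace X"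
    then obtain Y where Y: "closedin X Y" "invariant_subset G D \<alpha> Y" "Y \<noteq> {}" "Y \<noteq> topspace X"
      by blast
    let ?I = "{f \<in> carrier (continuous_functions X). \<forall>y\<in>Y. f y = 0}"
    have sub: "Y \<subseteq> topspace X"
      using Y(1) by (rule closedin_subset)
    then obtain x where x: "x \<in> topspace X - Y"
      using Y by blast
    moreover have "openin X (topspace X - Y)"
      using Y by (simp add: openin_diff)
    ultimately obtain h where h: "continuous_map X euclidean h" "h x = 1"
        "\<And>y. y \<in> topspace X - (topspace X - Y) \<Longrightarrow> h y = (0::complex)"
      using Urysohn_bump[OF assms] by metis
    have "(\<lambda>y\<in>topspace X. h y) \<in> ?I"
      using restrict_in_carrier_continuous_functions[OF h(1)] h(3) sub by auto
    moreover have "(\<lambda>y\<in>topspace X. h y) \<noteq> \<zero>\<^bsub>continuous_functions X\<^esub>"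
      using x h(2) by (auto simp: continuous_functions_def dest: fun_cong[where x = x])
    ultimately have "?I \<noteq> {\<zero>\<^bsub>continuous_functions X\<^esub>}"
      by blast
    moreover have "\<one>\<^bsub>continuous_functions X\<^esub> \<notin> ?I"
      using Y sub by (auto simp: continuous_functions_def)
    moreover have "\<one>\<^bsub>continuous_functions X\<^esub> \<in> carrier (continuous_functions X)"
      by (rule ring.ring_simprules(6)[OF cring.axioms(1)[OF cring_continuous_functions]])
    ultimately show False
      using simple invariant_ideal_vanishing_functions[OF assms sub Y(2)]
      unfolding action_simple_def by blast
  qed
next
  assume *: "\<not> (\<exists>Y. closedin X Y \<and> invariant_subset G D \<alpha> Y \<and> Y \<noteq> {} \<and> Y \<noteq> topspace X)"
  show "action_simple G X D \<alpha>"
    unfolding action_simple_def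
  proof (intro allI impI)
    fix I assume I: "invariant_ideal G X D \<alpha> I"
    then have ideal: "ideal I (continuous_functions X)"
      by (simp add: invariant_ideal_def)
    let ?Y = "{x \<in> topspace X. \<forall>f\<in>I. f x = 0}"
    consider "?Y = {}" | "?Y = topspace X"
      using * invariant_subset_common_zeros[OF assms I] closedin_common_zeros[OF ideal] by blast
    then show "I = {\<zero>\<^bsub>continuous_functions X\<^esub>} \<or> I = carrier (continuous_functions X)"
    proof cases
      case 1
      then show ?thesis
        using ideal_eq_carrier_if_no_common_zero[OF ideal assms(1)] by blast
    next
      case 2
      have zero: "\<zero>\<^bsub>continuous_functions X\<^esub> \<in> I"
        by (rule additive_subgroup.zero_closed[OF ideal.axioms(1)[OF ideal]])
      have vanish: "f x = 0" if "f \<in> I" "x \<in> topspace X" for f x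
        using 2 that by blast
      have "f = \<zero>\<^bsub>continuous_functions X\<^esub>" if f: "f \<in> I" for f
        by (rule continuous_functions_eqI[where X = X])
          (simp_all add: ideal_memD(1)[OF ideal] f zero vanish)
      with zero show ?thesis by blast
    qed
  qed
qed

end

text \<open>The compact Hausdorff hypothesis guards the equivalence about ideals, where it supplies
  Urysohn functions, continuity of the induced functions and finite subcovers. The equivalence with
  minimality rests on orbit closures alone.\<close>

theorem lemma3p7:
  fixes G :: "('g, 'm) monoid_scheme" and T :: "'g topology"
    and X :: "'x topology" and D :: "'g \<Rightarrow> 'x set" and \<alpha> :: "'g \<Rightarrow> 'x \<Rightarrow> 'x"
  assumes "partial_dynamical_system G T X D \<alpha>"
  shows "(compact_space X \<and> Hausdorff_space X \<longrightarrow>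
            (action_simple G X D \<alpha> \<longleftrightarrow>
             \<not> (\<exists>Y. closedin X Y \<and> invariant_subset G D \<alpha> Y \<and> Y \<noteq> {} \<and> Y \<noteq> topspace X))) \<and>
         (\<not> (\<exists>Y. closedin X Y \<and> invariant_subset G D \<alpha> Y \<and> Y \<noteq> {} \<and> Y \<noteq> topspace X) \<longleftrightarrow>
          minimal_system G X D \<alpha>)"
proof -
  interpret partial_dynamical_system G T X D \<alpha> by fact
  show ?thesis
    using action_simple_iff minimal_system_iff by blast
qed

end
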